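(* Let $n,d\ge 1$, let $f:\mathbb{R}^n\times\mathbb{N}\to\mathbb{R}^n$ be a function with each $f(\cdot,k)$ smooth, let $\sigma$ be a function from $\mathbb{R}^n\times\mathbb{N}$ to the $n\times d$ real matrices, and let $(M_k)_{k\in\mathbb{N}}$, $M_k=\Theta_k^T\Theta_k$ with $\Theta_k$ invertible, be constant (state-independent) symmetric positive definite $n\times n$ matrices that are uniformly positive definite. Consider $$a_{k+1}=f(a_k,k)+\sigma(a_k,k)\,w_{k+1},$$ where $(w_k)_{k\ge1}$ are independent $d$-dimensional Gaussian vectors with $w_k\sim\mathcal{N}(0,Q_k)$. Assume that there are $0<\beta<1$ and $C\ge 0$ such that for all $k\in\mathbb{N}$ and $a\in\mathbb{R}^n$ $$\lambda_{\max}\big(F_k(a)^TF_k(a)\big)\le\beta,\qquad F_k(a)=\Theta_{k+1}\frac{\partial f}{\partial a}(a,k)\Theta_k^{-1},$$ $$\mathrm{tr}\big(\sigma(a,k)^TM_{k+1}\sigma(a,k)Q_{k+1}\big)\le C.$$ Let $(a_k)$ and $(b_k)$ be two trajectories of the system, driven by distinct independent noise sequences, whose initial conditions $(a_0,b_0)$ are given by a probability distribution. Then for all $k\ge 0$ $$\mathbb{E}\big(\|a_k-b_k\|_{M_k}^2\big)\le\frac{2C}{1-\beta}+\beta^k\,\mathbb{E}\big(\|a_0-b_0\|_{M_0}^2\big).$$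
   Context: For a symmetric positive definite matrix $M$, $\|x\|_M^2=x^TMx$. The matrices $(M_k)$ are uniformly positive definite if there is $\alpha>0$ with $\lambda_{\min}(M_k)\ge\alpha$ for all $k$. Noise convention: $a_{k+1}=f(a_k,k)+\sigma(a_k,k)w_{k+1}$ and $b_{k+1}=f(b_k,k)+\sigma(b_k,k)w'_{k+1}$, where $(w_k)$ and $(w'_k)$ are independent of each other and of $(a_0,b_0)$ and have the same law.
   Formalization: Each σ(·,k) is additionally assumed Borel measurable; for an arbitrary function σ the expectations may be undefined, or the bound may fail because σ(a_0,0) can be correlated with w_1 although a_0 and w_1 are independent. *)

theory Defs
  imports "HOL-Probability.Probability"
begin

text \<open>Real matrices with \<open>m\<close> rows and \<open>n\<close> columns have type \<open>real^'n^'m\<close>.\<close>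

definition symmetric_matrix :: "real^'n^'n \<Rightarrow> bool" where
  "symmetric_matrix A \<longleftrightarrow> transpose A = A"

definition pos_def_matrix :: "real^'n^'n \<Rightarrow> bool" where
  "pos_def_matrix A \<longleftrightarrow> symmetric_matrix A \<and> (\<forall>x. x \<noteq> 0 \<longrightarrow> 0 < x \<bullet> (A *v x))"

definition pos_semidef_matrix :: "real^'n^'n \<Rightarrow> bool" where
  "pos_semidef_matrix A \<longleftrightarrow> symmetric_matrix A \<and> (\<forall>x. 0 \<le> x \<bullet> (A *v x))"

definition eigenvalues :: "real^'n^'n \<Rightarrow> real set" where
  "eigenvalues A = {c. \<exists>v. v \<noteq> 0 \<and> A *v v = c *\<^sub>R v}"

text \<open>Only used for symmetric matrices, whose set of real eigenvalues is finite and nonempty.\<close>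

definition lambda_max :: "real^'n^'n \<Rightarrow> real" where
  "lambda_max A = Max (eigenvalues A)"

definition lambda_min :: "real^'n^'n \<Rightarrow> real" where
  "lambda_min A = Min (eigenvalues A)"

definition uniformly_pos_def :: "(nat \<Rightarrow> real^'n^'n) \<Rightarrow> bool" where
  "uniformly_pos_def M \<longleftrightarrow> (\<exists>\<alpha>>0. \<forall>k. \<alpha> \<le> lambda_min (M k))"

definition sq_norm_wrt :: "real^'n^'n \<Rightarrow> real^'n \<Rightarrow> real" where
  "sq_norm_wrt M x = x \<bullet> (M *v x)"

text \<open>On a finite-dimensional space \<open>Ck_map m\<close> is the class \<open>C^m\<close>: quantifying the directional
  derivatives over all fixed directions is the same as using all entries of the derivative.\<close>

primrec Ck_map :: "nat \<Rightarrow> ('a::real_normed_vector \<Rightarrow> 'b::real_normed_vector) \<Rightarrow> bool" where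
  "Ck_map 0 f \<longleftrightarrow> continuous_on UNIV f"
| "Ck_map (Suc m) f \<longleftrightarrow>
     (\<forall>x. f differentiable (at x)) \<and> (\<forall>v. Ck_map m (\<lambda>x. frechet_derivative f (at x) v))"

definition smooth_map :: "('a::real_normed_vector \<Rightarrow> 'b::real_normed_vector) \<Rightarrow> bool" where
  "smooth_map f \<longleftrightarrow> (\<forall>m. Ck_map m f)"

text \<open>The normal law on the line with mean \<open>\<mu>\<close> and variance \<open>v\<close>; a point mass if \<open>v = 0\<close>.
  (The second parameter of \<^const>\<open>normal_density\<close> is the standard deviation.)\<close>

definition normal_law :: "real \<Rightarrow> real \<Rightarrow> real measure" where
  "normal_law \<mu> v =
     (if v = 0 then return borel \<mu> else density lborel (\<lambda>x. ennreal (normal_density \<mu> (sqrt v) x)))"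

text \<open>\<open>X\<close> has law \<open>N(m, Q)\<close>, where the covariance \<open>Q\<close> may be singular: every linear functional
  of \<open>X\<close> is normal with the corresponding mean and variance.\<close>

definition gaussian_vector ::
    "'w measure \<Rightarrow> ('w \<Rightarrow> real^'d) \<Rightarrow> real^'d \<Rightarrow> real^'d^'d \<Rightarrow> bool" where
  "gaussian_vector P X m Q \<longleftrightarrow>
     X \<in> borel_measurable P \<and> pos_semidef_matrix Q \<and>
     (\<forall>u. distr P borel (\<lambda>\<omega>. u \<bullet> X \<omega>) = normal_law (u \<bullet> m) (u \<bullet> (Q *v u)))"

text \<open>The noise sequence is indexed from 1; its value at index 0 plays no role.\<close>

definition gaussian_noise ::
    "'w measure \<Rightarrow> (nat \<Rightarrow> real^'d^'d) \<Rightarrow> (nat \<Rightarrow> 'w \<Rightarrow> real^'d) \<Rightarrow> bool" where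
  "gaussian_noise P Q w \<longleftrightarrow>
     (\<forall>k\<ge>1. gaussian_vector P (w k) 0 (Q k)) \<and>
     prob_space.indep_vars P (\<lambda>_. borel) w {1..}"

text \<open>Independence of two random elements, as in the library's \<^const>\<open>prob_space.indep_var\<close>,
  which however requires both to take values in the same type.\<close>

definition indep_rv ::
    "'w measure \<Rightarrow> 'a measure \<Rightarrow> ('w \<Rightarrow> 'a) \<Rightarrow> 'b measure \<Rightarrow> ('w \<Rightarrow> 'b) \<Rightarrow> bool" where
  "indep_rv P S X T Y \<longleftrightarrow>
     X \<in> measurable P S \<and> Y \<in> measurable P T \<and>
     prob_space.indep_set P
       (sigma_sets (space P) {X -` A \<inter> space P | A. A \<in> sets S})
       (sigma_sets (space P) {Y -` A \<inter> space P | A. A \<in> sets T})"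

lemma (in prob_space) indep_rv_eq_indep_var: "indep_rv M S X T Y \<longleftrightarrow> indep_var S X T Y"
  by (auto simp: indep_rv_def indep_var_eq)

text \<open>A whole noise sequence as one random element of the product space.\<close>

definition noise_path :: "(nat \<Rightarrow> 'w \<Rightarrow> real^'d) \<Rightarrow> 'w \<Rightarrow> (nat \<Rightarrow> real^'d)" where
  "noise_path w = (\<lambda>\<omega>. \<lambda>k\<in>{1..}. w k \<omega>)"

abbreviation noise_space :: "(nat \<Rightarrow> real^'d) measure" where
  "noise_space \<equiv> \<Pi>\<^sub>M k\<in>{1..}. borel"

definition trajectory ::
    "'w measure \<Rightarrow> (real^'n \<Rightarrow> nat \<Rightarrow> real^'n) \<Rightarrow> (real^'n \<Rightarrow> nat \<Rightarrow> real^'d^'n) \<Rightarrow>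
     (nat \<Rightarrow> 'w \<Rightarrow> real^'d) \<Rightarrow> (nat \<Rightarrow> 'w \<Rightarrow> real^'n) \<Rightarrow> bool" where
  "trajectory P f \<sigma> w a \<longleftrightarrow>
     (\<forall>k. \<forall>\<omega>\<in>space P. a (Suc k) \<omega> = f (a k \<omega>) k + \<sigma> (a k \<omega>) k *v w (Suc k) \<omega>)"

definition gen_jacobian ::
    "(real^'n \<Rightarrow> nat \<Rightarrow> real^'n) \<Rightarrow> (nat \<Rightarrow> real^'n^'n) \<Rightarrow> nat \<Rightarrow> real^'n \<Rightarrow> real^'n^'n" where
  "gen_jacobian f \<Theta> k a =
     \<Theta> (Suc k) ** jacobian (\<lambda>x. f x k) (at a) ** matrix_inv (\<Theta> k)"

end

theory Submission
  imports Defs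
begin

text \<open>In the coordinates \<open>z = \<Theta>\<^sub>k x\<close> the norm given by \<open>M\<^sub>k\<close> becomes the Euclidean one, and \<open>F\<^sub>k\<close> becomes
  the derivative of the deterministic part of step \<open>k\<close>. The eigenvalue hypothesis says that its operator norm
  is at most \<open>sqrt \<beta>\<close>, so by the mean value inequality the deterministic part shrinks squared
  distances by the factor \<open>\<beta>\<close> (\<open>norm_contraction\<close>).

  The noise entering step \<open>k\<close> is independent of the pair of states \<open>(a\<^sub>k, b\<^sub>k)\<close>, so these states
  can be held fixed while integrating over the noise (\<open>nn_integral_indep_rv\<close>). With the states
  fixed, the new difference is a constant plus two independent centred Gaussian vectors. All cross
  terms of its squared norm have mean zero, and each of the two vectors contributes its trace, which
  is at most \<open>C\<close> (\<open>gaussian_difference_second_moment\<close>). Hence the mean square distances satisfy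
  \<open>N\<^sub>k\<^sub>+\<^sub>1 \<le> \<beta> N\<^sub>k + 2 C\<close> (\<open>mean_square_step\<close>), and since \<open>2 C / (1 - \<beta>)\<close> is the fixed
  point of this affine recursion, the bound follows by induction.

  The independence needed at each step is carried through the induction in a stronger form: the pair
  of states is independent of the whole future of both noise sequences
  (\<open>trajectory_indep_future_noise\<close>). All expectations are integrals in \<open>[0, \<infinity>]\<close>, so the argument
  covers initial laws of infinite second moment.\<close>

section \<open>Independence of random elements of different types\<close>

context prob_space
begin

text \<open>By Dynkin's theorem the product rule need only be tested on intersection-stable generators, such as
  the measurable rectangles of a product space.\<close>

lemma indep_rv_generatorI:
  assumes X: "X \<in> measurable M S" and Y: "Y \<in> measurable M T"
    and S: "sets S = sigma_sets (space S) G" "Int_stable G" "G \<subseteq> sets S"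
    and T: "sets T = sigma_sets (space T) H" "Int_stable H" "H \<subseteq> sets T"
    and prod: "\<And>A B. A \<in> G \<Longrightarrow> B \<in> H \<Longrightarrow>
      prob ((X -` A \<inter> space M) \<inter> (Y -` B \<inter> space M)) = prob (X -` A \<inter> space M) * prob (Y -` B \<inter> space M)"
  shows "indep_rv M S X T Y"
proof -
  have vimage: "sigma_sets (space M) {Z -` A \<inter> space M |A. A \<in> sets U} =
      sigma_sets (space M) {Z -` A \<inter> space M |A. A \<in> K}"
    if "Z \<in> measurable M U" "sets U = sigma_sets (space U) K" "K \<subseteq> sets U" for Z :: "'a \<Rightarrow> 'z" and U K
    using sigma_sets_vimage_commute[of Z "space M" "space U" K] that
    by (simp add: sigma_sets_sigma_sets_eq measurable_def subset_eq) (auto intro!: sigma_sets_sigma_sets_eq)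
  have int: "Int_stable {Z -` A \<inter> space M |A. A \<in> K}" if "Int_stable K" for Z :: "'a \<Rightarrow> 'z" and K
  proof (rule Int_stableI, clarify)
    fix A B assume "A \<in> K" "B \<in> K"
    then have "A \<inter> B \<in> K" using that by (rule Int_stableD[rotated])
    moreover have "(Z -` A \<inter> space M) \<inter> (Z -` B \<inter> space M) = Z -` (A \<inter> B) \<inter> space M" by auto
    ultimately show "\<exists>C. (Z -` A \<inter> space M) \<inter> (Z -` B \<inter> space M) = Z -` C \<inter> space M \<and> C \<in> K"
      by blast
  qed
  have ind: "indep_set (sigma_sets (space M) {X -` A \<inter> space M |A. A \<in> G})
      (sigma_sets (space M) {Y -` A \<inter> space M |A. A \<in> H})"
  proof (intro indep_set_sigma_sets indep_setI)
    show "Int_stable {X -` A \<inter> space M |A. A \<in> G}" "Int_stable {Y -` A \<inter> space M |A. A \<in> H}"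
      by (intro exI conjI int S T)+
    show "{X -` A \<inter> space M |A. A \<in> G} \<subseteq> events"
      using S(3) measurable_sets[OF X] by blast
    show "{Y -` A \<inter> space M |A. A \<in> H} \<subseteq> events"
      using T(3) measurable_sets[OF Y] by blast
    fix a b
    assume "a \<in> {X -` A \<inter> space M |A. A \<in> G}" "b \<in> {Y -` A \<inter> space M |A. A \<in> H}"
    then show "prob (a \<inter> b) = prob a * prob b"
      using prod by blast
  qed
  show ?thesis
    unfolding indep_rv_def vimage[OF X S(1,3)] vimage[OF Y T(1,3)] using X Y ind by auto
qed

lemma indep_rv_prob:
  assumes "indep_rv M S X T Y" "A \<in> sets S" "B \<in> sets T"
  shows "prob ((X -` A \<inter> space M) \<inter> (Y -` B \<inter> space M)) = prob (X -` A \<inter> space M) * prob (Y -` B \<inter> space M)"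
  using assms unfolding indep_rv_def
  by (intro indep_setD) (auto intro!: sigma_sets.Basic)

lemma indep_rv_compose:
  assumes ind: "indep_rv M S X T Y" and f: "f \<in> measurable S S'" and g: "g \<in> measurable T T'"
  shows "indep_rv M S' (\<lambda>\<omega>. f (X \<omega>)) T' (\<lambda>\<omega>. g (Y \<omega>))"
proof (rule indep_rv_generatorI[where G = "sets S'" and H = "sets T'"])
  have X: "X \<in> measurable M S" and Y: "Y \<in> measurable M T"
    using ind by (auto simp: indep_rv_def)
  show "(\<lambda>\<omega>. f (X \<omega>)) \<in> measurable M S'" "(\<lambda>\<omega>. g (Y \<omega>)) \<in> measurable M T'"
    using X Y f g by measurable
  fix A B assume A: "A \<in> sets S'" and B: "B \<in> sets T'"
  have *: "(\<lambda>\<omega>. f (X \<omega>)) -` A \<inter> space M = X -` (f -` A \<inter> space S) \<inter> space M"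
      "(\<lambda>\<omega>. g (Y \<omega>)) -` B \<inter> space M = Y -` (g -` B \<inter> space T) \<inter> space M"
    using measurable_space[OF X] measurable_space[OF Y] by auto
  show "prob (((\<lambda>\<omega>. f (X \<omega>)) -` A \<inter> space M) \<inter> ((\<lambda>\<omega>. g (Y \<omega>)) -` B \<inter> space M)) =
      prob ((\<lambda>\<omega>. f (X \<omega>)) -` A \<inter> space M) * prob ((\<lambda>\<omega>. g (Y \<omega>)) -` B \<inter> space M)"
    unfolding * by (rule indep_rv_prob[OF ind measurable_sets[OF f A] measurable_sets[OF g B]])
qed (auto simp: sets.sigma_sets_eq sets.Int_stable)

lemma indep_rv_cong:
  assumes ind: "indep_rv M S X T Y" and X': "\<And>\<omega>. \<omega> \<in> space M \<Longrightarrow> X \<omega> = X' \<omega>"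
  shows "indep_rv M S X' T Y"
proof -
  have "X' -` A \<inter> space M = X -` A \<inter> space M" for A
    using X' by auto
  moreover have "X' \<in> measurable M S \<longleftrightarrow> X \<in> measurable M S"
    using X' by (intro measurable_cong) simp
  ultimately show ?thesis
    using ind by (simp add: indep_rv_def)
qed

text \<open>If the rows of a two by two array of random elements are independent of each other, and within each
  row the entries are independent, then all four entries are independent, and so the columns are
  independent of each other. This regroups two noise sequences, each split into the present value
  and the future, into the two present values and the two futures.\<close>

lemma indep_rv_interchange:
  assumes XY: "indep_rv M (S1 \<Otimes>\<^sub>M S2) (\<lambda>\<omega>. (X1 \<omega>, X2 \<omega>)) (T1 \<Otimes>\<^sub>M T2) (\<lambda>\<omega>. (Y1 \<omega>, Y2 \<omega>))"
    and X: "indep_rv M S1 X1 S2 X2" and Y: "indep_rv M T1 Y1 T2 Y2"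
  shows "indep_rv M (S1 \<Otimes>\<^sub>M T1) (\<lambda>\<omega>. (X1 \<omega>, Y1 \<omega>)) (S2 \<Otimes>\<^sub>M T2) (\<lambda>\<omega>. (X2 \<omega>, Y2 \<omega>))"
proof (rule indep_rv_generatorI[OF _ _ sets_pair_measure[folded space_pair_measure]
      Int_stable_pair_measure_generator _ sets_pair_measure[folded space_pair_measure]
      Int_stable_pair_measure_generator])
  have m[measurable]: "X1 \<in> measurable M S1" "X2 \<in> measurable M S2"
      "Y1 \<in> measurable M T1" "Y2 \<in> measurable M T2"
    using X Y by (auto simp: indep_rv_def)
  show "(\<lambda>\<omega>. (X1 \<omega>, Y1 \<omega>)) \<in> measurable M (S1 \<Otimes>\<^sub>M T1)"
      "(\<lambda>\<omega>. (X2 \<omega>, Y2 \<omega>)) \<in> measurable M (S2 \<Otimes>\<^sub>M T2)"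
    by measurable
  show "{a \<times> b |a b. a \<in> sets S1 \<and> b \<in> sets T1} \<subseteq> sets (S1 \<Otimes>\<^sub>M T1)"
       "{a \<times> b |a b. a \<in> sets S2 \<and> b \<in> sets T2} \<subseteq> sets (S2 \<Otimes>\<^sub>M T2)"
    by auto
  have rect: "prob (((\<lambda>\<omega>. (X1 \<omega>, Y1 \<omega>)) -` (A1 \<times> B1) \<inter> space M) \<inter> ((\<lambda>\<omega>. (X2 \<omega>, Y2 \<omega>)) -` (A2 \<times> B2) \<inter> space M))
     = (prob (X1 -` A1 \<inter> space M) * prob (X2 -` A2 \<inter> space M)) *
       (prob (Y1 -` B1 \<inter> space M) * prob (Y2 -` B2 \<inter> space M))"
    if "A1 \<in> sets S1" "A2 \<in> sets S2" "B1 \<in> sets T1" "B2 \<in> sets T2" for A1 A2 B1 B2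
  proof -
    have sets: "((\<lambda>\<omega>. (X1 \<omega>, Y1 \<omega>)) -` (A1 \<times> B1) \<inter> space M) \<inter> ((\<lambda>\<omega>. (X2 \<omega>, Y2 \<omega>)) -` (A2 \<times> B2) \<inter> space M)
        = ((\<lambda>\<omega>. (X1 \<omega>, X2 \<omega>)) -` (A1 \<times> A2) \<inter> space M) \<inter> ((\<lambda>\<omega>. (Y1 \<omega>, Y2 \<omega>)) -` (B1 \<times> B2) \<inter> space M)"
       "(\<lambda>\<omega>. (X1 \<omega>, X2 \<omega>)) -` (A1 \<times> A2) \<inter> space M = (X1 -` A1 \<inter> space M) \<inter> (X2 -` A2 \<inter> space M)"
       "(\<lambda>\<omega>. (Y1 \<omega>, Y2 \<omega>)) -` (B1 \<times> B2) \<inter> space M = (Y1 -` B1 \<inter> space M) \<inter> (Y2 -` B2 \<inter> space M)"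
      by auto
    show ?thesis
      unfolding sets(1) using that
      by (subst indep_rv_prob[OF XY])
         (auto simp: sets(2,3) indep_rv_prob[OF X] indep_rv_prob[OF Y])
  qed
  fix A B
  assume "A \<in> {a \<times> b |a b. a \<in> sets S1 \<and> b \<in> sets T1}" "B \<in> {a \<times> b |a b. a \<in> sets S2 \<and> b \<in> sets T2}"
  then obtain A1 B1 A2 B2 where AB: "A = A1 \<times> B1" "B = A2 \<times> B2"
    and s: "A1 \<in> sets S1" "A2 \<in> sets S2" "B1 \<in> sets T1" "B2 \<in> sets T2"
    by auto
  \<comment> \<open>The probability of each column is the four-fold product with the whole space in the other column.\<close>
  have full: "X1 -` space S1 \<inter> space M = space M" "X2 -` space S2 \<inter> space M = space M"
    "Y1 -` space T1 \<inter> space M = space M" "Y2 -` space T2 \<inter> space M = space M"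
    "(\<lambda>\<omega>. (X1 \<omega>, Y1 \<omega>)) -` (space S1 \<times> space T1) \<inter> space M = space M"
    "(\<lambda>\<omega>. (X2 \<omega>, Y2 \<omega>)) -` (space S2 \<times> space T2) \<inter> space M = space M"
    using m[THEN measurable_space] by auto
  have sub: "(U -` A \<inter> space M) \<inter> space M = U -` A \<inter> space M"
            "space M \<inter> (U -` A \<inter> space M) = U -` A \<inter> space M" for U :: "'a \<Rightarrow> 'z" and A
    by auto
  have A: "prob ((\<lambda>\<omega>. (X1 \<omega>, Y1 \<omega>)) -` A \<inter> space M) = prob (X1 -` A1 \<inter> space M) * prob (Y1 -` B1 \<inter> space M)"
    using rect[of A1 "space S2" B1 "space T2"] s unfolding AB full sub by (simp add: prob_space)
  have B: "prob ((\<lambda>\<omega>. (X2 \<omega>, Y2 \<omega>)) -` B \<inter> space M) = prob (X2 -` A2 \<inter> space M) * prob (Y2 -` B2 \<inter> space M)"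
    using rect[of "space S1" A2 "space T1" B2] s unfolding AB full sub by (simp add: prob_space)
  show "prob (((\<lambda>\<omega>. (X1 \<omega>, Y1 \<omega>)) -` A \<inter> space M) \<inter> ((\<lambda>\<omega>. (X2 \<omega>, Y2 \<omega>)) -` B \<inter> space M)) =
      prob ((\<lambda>\<omega>. (X1 \<omega>, Y1 \<omega>)) -` A \<inter> space M) * prob ((\<lambda>\<omega>. (X2 \<omega>, Y2 \<omega>)) -` B \<inter> space M)"
    unfolding A B using rect[OF s] by (simp add: AB)
qed

lemma indep_rv_assoc:
  assumes XYZ: "indep_rv M S X (T \<Otimes>\<^sub>M U) (\<lambda>\<omega>. (Y \<omega>, Z \<omega>))" and YZ: "indep_rv M T Y U Z"
  shows "indep_rv M (S \<Otimes>\<^sub>M T) (\<lambda>\<omega>. (X \<omega>, Y \<omega>)) U Z"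
proof -
  \<comment> \<open>The interchange rule, with a constant as second entry of the row of \<open>X\<close>.\<close>
  let ?I = "count_space UNIV :: unit measure"
  have X: "X \<in> measurable M S"
    using XYZ by (simp add: indep_rv_def)
  have const: "indep_rv M S X ?I (\<lambda>_. ())"
  proof (rule indep_rv_generatorI[where G = "sets S" and H = "sets ?I"])
    fix A B assume "B \<in> sets ?I"
    have "B = {} \<or> B = UNIV" by auto
    then show "prob ((X -` A \<inter> space M) \<inter> ((\<lambda>_. ()) -` B \<inter> space M)) =
        prob (X -` A \<inter> space M) * prob ((\<lambda>_. ()) -` B \<inter> space M)"
      by (elim disjE) (simp_all add: prob_space Int_assoc)
  qed (use X in \<open>auto simp: sets.sigma_sets_eq sets.Int_stable simp del: sets_count_space\<close>)
  have "indep_rv M (S \<Otimes>\<^sub>M ?I) (\<lambda>\<omega>. (X \<omega>, ())) (T \<Otimes>\<^sub>M U) (\<lambda>\<omega>. (Y \<omega>, Z \<omega>))"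
    using indep_rv_compose[OF XYZ, of "\<lambda>x. (x, ())" "S \<Otimes>\<^sub>M ?I" "\<lambda>p. p"] by simp
  from indep_rv_interchange[OF this const YZ]
  have "indep_rv M (S \<Otimes>\<^sub>M T) (\<lambda>\<omega>. (X \<omega>, Y \<omega>)) (?I \<Otimes>\<^sub>M U) (\<lambda>\<omega>. ((), Z \<omega>))" .
  from indep_rv_compose[OF this, of "\<lambda>p. p" _ snd U] show ?thesis
    by simp
qed

lemma distr_indep_rv:
  assumes ind: "indep_rv M S X T Y"
  shows "distr M (S \<Otimes>\<^sub>M T) (\<lambda>\<omega>. (X \<omega>, Y \<omega>)) = distr M S X \<Otimes>\<^sub>M distr M T Y"
proof (rule pair_measure_eqI[symmetric])
  have X[measurable]: "X \<in> measurable M S" and Y[measurable]: "Y \<in> measurable M T"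
    using ind by (auto simp: indep_rv_def)
  show "sigma_finite_measure (distr M S X)" "sigma_finite_measure (distr M T Y)"
    by (intro prob_space_imp_sigma_finite prob_space_distr X Y)+
  show "sets (distr M S X \<Otimes>\<^sub>M distr M T Y) = sets (distr M (S \<Otimes>\<^sub>M T) (\<lambda>\<omega>. (X \<omega>, Y \<omega>)))"
    by simp
  fix A B assume "A \<in> sets (distr M S X)" "B \<in> sets (distr M T Y)"
  then have AB[measurable]: "A \<in> sets S" "B \<in> sets T" by auto
  have "(\<lambda>\<omega>. (X \<omega>, Y \<omega>)) -` (A \<times> B) \<inter> space M = (X -` A \<inter> space M) \<inter> (Y -` B \<inter> space M)" by auto
  then show "emeasure (distr M S X) A * emeasure (distr M T Y) B =
      emeasure (distr M (S \<Otimes>\<^sub>M T) (\<lambda>\<omega>. (X \<omega>, Y \<omega>))) (A \<times> B)"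
    using indep_rv_prob[OF ind AB]
    by (simp add: emeasure_distr emeasure_eq_measure ennreal_mult)
qed

text \<open>Conditioning on \<open>X\<close> in integral form: the joint law is a product, so \<open>X\<close> may be frozen while \<open>Y\<close> is
  integrated out.\<close>

lemma nn_integral_indep_rv:
  assumes ind: "indep_rv M S X T Y" and h[measurable]: "h \<in> borel_measurable (S \<Otimes>\<^sub>M T)"
  shows "(\<integral>\<^sup>+\<omega>. h (X \<omega>, Y \<omega>) \<partial>M) = (\<integral>\<^sup>+\<omega>. (\<integral>\<^sup>+\<omega>'. h (X \<omega>, Y \<omega>') \<partial>M) \<partial>M)"
proof -
  have X[measurable]: "X \<in> measurable M S" and Y[measurable]: "Y \<in> measurable M T"
    using ind by (auto simp: indep_rv_def)
  interpret DY: prob_space "distr M T Y" by (rule prob_space_distr[OF Y])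
  have "(\<integral>\<^sup>+\<omega>. h (X \<omega>, Y \<omega>) \<partial>M) = (\<integral>\<^sup>+p. h p \<partial>(distr M S X \<Otimes>\<^sub>M distr M T Y))"
    by (simp add: distr_indep_rv[OF ind, symmetric] nn_integral_distr)
  also have "\<dots> = (\<integral>\<^sup>+x. (\<integral>\<^sup>+y. h (x, y) \<partial>distr M T Y) \<partial>distr M S X)"
    by (subst DY.nn_integral_fst[symmetric]) simp_all
  also have "\<dots> = (\<integral>\<^sup>+\<omega>. (\<integral>\<^sup>+y. h (X \<omega>, y) \<partial>distr M T Y) \<partial>M)"
    by (rule nn_integral_distr) (use DY.borel_measurable_nn_integral_fst[of h S] in simp_all)
  also have "\<dots> = (\<integral>\<^sup>+\<omega>. (\<integral>\<^sup>+\<omega>'. h (X \<omega>, Y \<omega>') \<partial>M) \<partial>M)"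
    by (intro nn_integral_cong nn_integral_distr) (auto intro: measurable_compose[OF measurable_Pair1' h] simp: measurable_space[OF X])
  finally show ?thesis .
qed

end

section \<open>The Rayleigh quotient and the contraction estimate\<close>

lemma inner_symmetric_matrix:
  fixes A :: "real^'n^'n"
  assumes "symmetric_matrix A"
  shows "(A *v x) \<bullet> y = x \<bullet> (A *v y)"
  using assms dot_lmul_matrix[of x A y] transpose_matrix_vector[of A x]
  by (simp add: symmetric_matrix_def)

text \<open>Eigenvectors for distinct eigenvalues are orthogonal, hence linearly independent. Finiteness is what
  makes \<^const>\<open>Max\<close> in \<^const>\<open>lambda_max\<close> an upper bound.\<close>

lemma finite_eigenvalues_symmetric:
  fixes A :: "real^'n^'n"
  assumes "symmetric_matrix A"
  shows "finite (eigenvalues A)"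
proof -
  define v where "v c = (SOME v. v \<noteq> 0 \<and> A *v v = c *\<^sub>R v)" for c
  have v: "v c \<noteq> 0" "A *v v c = c *\<^sub>R v c" if "c \<in> eigenvalues A" for c
    using someI_ex[of "\<lambda>v. v \<noteq> 0 \<and> A *v v = c *\<^sub>R v"] that
    by (auto simp: eigenvalues_def v_def)
  note sym = inner_symmetric_matrix[OF assms]
  have orth: "v c \<bullet> v d = 0" if "c \<in> eigenvalues A" "d \<in> eigenvalues A" "c \<noteq> d" for c d
    using sym[of "v c" "v d"] v that by simp
  have "inj_on v (eigenvalues A)"
    using orth v(1) by (intro inj_onI) (metis inner_eq_zero_iff)
  moreover have "independent (v ` eigenvalues A)"
    using orth v(1) by (intro pairwise_orthogonal_independent) (auto simp: pairwise_def orthogonal_def)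
  then have "finite (v ` eigenvalues A)"
    by (rule independent_imp_finite)
  ultimately show ?thesis
    by (rule finite_imageD[rotated])
qed

text \<open>The quadratic form attains a maximum \<open>m\<close> on the compact unit sphere, at some \<open>v\<close>. The form of
  \<open>m I - A\<close> is then nonnegative and vanishes at \<open>v\<close>, so its gradient vanishes there: \<open>v\<close> is an
  eigenvector for \<open>m\<close>.\<close>

lemma rayleigh_le_lambda_max:
  fixes A :: "real^'n^'n"
  assumes "symmetric_matrix A"
  shows "x \<bullet> (A *v x) \<le> lambda_max A * (x \<bullet> x)"
proof -
  note sym = inner_symmetric_matrix[OF assms]
  have "continuous_on (sphere 0 1) (\<lambda>x. x \<bullet> (A *v x))"
    by (intro continuous_intros)
  moreover have "sphere (0 :: real^'n) 1 \<noteq> {}" by simp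
  ultimately have "\<exists>v\<in>sphere 0 1. \<forall>y\<in>sphere 0 1. y \<bullet> (A *v y) \<le> v \<bullet> (A *v v)"
    by (intro continuous_attains_sup compact_sphere)
  then obtain v where v: "v \<in> sphere 0 1"
    and max: "\<And>y. y \<in> sphere 0 1 \<Longrightarrow> y \<bullet> (A *v y) \<le> v \<bullet> (A *v v)"
    by blast
  define m where "m = v \<bullet> (A *v v)"
  have ray: "y \<bullet> (A *v y) \<le> m * (y \<bullet> y)" for y
  proof (cases "y = 0")
    case False
    let ?z = "(1 / norm y) *\<^sub>R y"
    have "?z \<bullet> (A *v ?z) \<le> m"
      unfolding m_def using False by (intro max) simp
    then show ?thesis
      using False
      by (simp add: matrix_vector_mult_scaleR divide_simps power2_eq_square[symmetric] power2_norm_eq_inner[symmetric])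
  qed simp
  define r where "r = m *\<^sub>R v - A *v v"
  have vv: "v \<bullet> v = 1" using v by (simp add: norm_eq_1)
  \<comment> \<open>The nonnegative form of \<open>m I - A\<close> at \<open>v + t r\<close>, where \<open>r\<close> is half its gradient at \<open>v\<close>.\<close>
  have quad: "0 \<le> 2 * t * (r \<bullet> r) + t\<^sup>2 * (m * (r \<bullet> r) - r \<bullet> (A *v r))" for t
  proof -
    have 1: "(v + t *\<^sub>R r) \<bullet> (A *v (v + t *\<^sub>R r)) \<le> m * ((v + t *\<^sub>R r) \<bullet> (v + t *\<^sub>R r))"
      by (rule ray)
    have 2: "(v + t *\<^sub>R r) \<bullet> (A *v (v + t *\<^sub>R r)) = m + 2 * t * (r \<bullet> (A *v v)) + t\<^sup>2 * (r \<bullet> (A *v r))"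
      using sym[of v r]
      by (simp add: matrix_vector_right_distrib matrix_vector_mult_scaleR inner_add_left inner_add_right m_def
          power2_eq_square algebra_simps inner_commute)
    have 3: "(v + t *\<^sub>R r) \<bullet> (v + t *\<^sub>R r) = 1 + 2 * t * (r \<bullet> v) + t\<^sup>2 * (r \<bullet> r)"
      by (simp add: inner_add_left inner_add_right vv power2_eq_square algebra_simps inner_commute)
    have 4: "r \<bullet> r = m * (r \<bullet> v) - r \<bullet> (A *v v)"
      by (subst (2) r_def) (simp add: inner_diff_right)
    have "2 * t * (m * (r \<bullet> v) - r \<bullet> (A *v v)) + t\<^sup>2 * (m * (r \<bullet> r) - r \<bullet> (A *v r)) \<ge> 0"
      using 1 unfolding 2 3 by (simp add: algebra_simps)
    then show ?thesis
      unfolding 4[symmetric] .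
  qed
  have "r \<bullet> r = 0"
  proof (rule ccontr)
    assume "r \<bullet> r \<noteq> 0"
    then have s: "r \<bullet> r > 0" by simp
    define q where "q = m * (r \<bullet> r) - r \<bullet> (A *v r)"
    have q: "0 \<le> q" using ray[of r] by (simp add: q_def)
    \<comment> \<open>A step along \<open>- r\<close>, short enough for the linear term to win; the \<open>+ 1\<close> avoids division by zero.\<close>
    define t where "t = - (r \<bullet> r) / (q + 1)"
    have "2 * t * (r \<bullet> r) + t\<^sup>2 * q = (r \<bullet> r)\<^sup>2 / (q+1)\<^sup>2 * (- 2 * (q + 1) + q)"
      using q by (simp add: t_def power2_eq_square divide_simps) (simp add: algebra_simps)
    also have "\<dots> < 0" using q s by (intro mult_pos_neg) auto
    finally show False using quad[of t] by (simp add: q_def)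
  qed
  then have "m \<in> eigenvalues A"
    using v by (auto simp: eigenvalues_def r_def intro!: exI[of _ v])
  then have "m \<le> lambda_max A"
    unfolding lambda_max_def by (intro Max_ge finite_eigenvalues_symmetric assms)
  then show ?thesis
    using ray[of x] by (meson inner_ge_zero mult_right_mono order_trans)
qed

lemma sq_norm_wrt_gram:
  fixes \<Theta> :: "real^'n^'n"
  shows "sq_norm_wrt (transpose \<Theta> ** \<Theta>) x = (norm (\<Theta> *v x))\<^sup>2"
  by (metis dot_lmul_matrix inner_commute matrix_vector_mul_assoc power2_norm_eq_inner
      sq_norm_wrt_def transpose_matrix_vector)

lemma norm_le_of_lambda_max_gram:
  fixes A :: "real^'n^'n"
  assumes "lambda_max (transpose A ** A) \<le> \<beta>"
  shows "norm (A *v x) \<le> sqrt \<beta> * norm x"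
proof -
  have "(norm (A *v x))\<^sup>2 \<le> lambda_max (transpose A ** A) * (x \<bullet> x)"
    using rayleigh_le_lambda_max[of "transpose A ** A" x] sq_norm_wrt_gram[of A x]
    by (simp add: symmetric_matrix_def matrix_transpose_mul sq_norm_wrt_def)
  also have "\<dots> \<le> \<beta> * (norm x)\<^sup>2"
    unfolding power2_norm_eq_inner using assms by (intro mult_right_mono) auto
  finally have "sqrt ((norm (A *v x))\<^sup>2) \<le> sqrt (\<beta> * (norm x)\<^sup>2)"
    by (rule real_sqrt_le_mono)
  then show ?thesis
    by (simp add: real_sqrt_mult)
qed

lemma matrix_inv_mult:
  fixes A :: "real^'n^'n"
  assumes "invertible A"
  shows "matrix_inv A ** A = mat 1"
  using someI_ex[OF assms[unfolded invertible_def]] by (simp add: matrix_inv_def)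

text \<open>The map \<open>g z = \<Theta>\<^sub>k\<^sub>+\<^sub>1 f (\<Theta>\<^sub>k\<^sup>-\<^sup>1 z)\<close> has the derivative \<open>F\<^sub>k\<close>, whose operator norm is at most
  \<open>sqrt \<beta>\<close>; apply the mean value inequality to \<open>g\<close>. The weights being independent of the state is what
  allows the whole space to be rescaled at once.\<close>

lemma norm_contraction:
  fixes f :: "real^'n \<Rightarrow> nat \<Rightarrow> real^'n"
  assumes diff: "\<And>x. (\<lambda>x. f x k) differentiable (at x)"
    and inv: "invertible (\<Theta> k)" and \<beta>: "0 \<le> \<beta>"
    and F: "\<And>x. lambda_max (transpose (gen_jacobian f \<Theta> k x) ** gen_jacobian f \<Theta> k x) \<le> \<beta>"
  shows "(norm (\<Theta> (Suc k) *v (f x k - f y k)))\<^sup>2 \<le> \<beta> * (norm (\<Theta> k *v (x - y)))\<^sup>2"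
proof -
  let ?T = "matrix_inv (\<Theta> k)"
  define g where "g z = \<Theta> (Suc k) *v f (?T *v z) k" for z
  have der: "(g has_derivative (\<lambda>h. gen_jacobian f \<Theta> k (?T *v z) *v h)) (at z within UNIV)" for z
  proof -
    have "((\<lambda>z. ?T *v z) has_derivative (\<lambda>h. ?T *v h)) (at z)"
      by (intro linear_imp_has_derivative matrix_vector_mul_linear)
    then have "((\<lambda>z. f (?T *v z) k) has_derivative (\<lambda>h. jacobian (\<lambda>x. f x k) (at (?T *v z)) *v (?T *v h))) (at z)"
      by (rule has_derivative_compose) (use diff jacobian_works in blast)
    from has_derivative_compose[OF this linear_imp_has_derivative[OF matrix_vector_mul_linear[of "\<Theta> (Suc k)"]]]
    show ?thesis
      by (simp add: g_def[abs_def] gen_jacobian_def matrix_vector_mul_assoc matrix_mul_assoc)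
  qed
  have onorm: "onorm (\<lambda>h. gen_jacobian f \<Theta> k (?T *v z) *v h) \<le> sqrt \<beta>" for z
    using \<beta> by (intro onorm_le norm_le_of_lambda_max_gram F)
  have "norm (g (\<Theta> k *v x) - g (\<Theta> k *v y)) \<le> sqrt \<beta> * norm (\<Theta> k *v x - \<Theta> k *v y)"
    by (rule differentiable_bound[OF convex_UNIV der onorm]) auto
  moreover have "?T *v (\<Theta> k *v z) = z" for z
    by (simp add: matrix_vector_mul_assoc matrix_inv_mult[OF inv])
  ultimately have "norm (\<Theta> (Suc k) *v (f x k - f y k)) \<le> sqrt \<beta> * norm (\<Theta> k *v (x - y))"
    by (simp add: g_def matrix_vector_mult_diff_distrib)
  from power_mono[OF this, of 2] \<beta> show ?thesis
    by (simp add: power_mult_distrib)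
qed

section \<open>Second moments of Gaussian vectors\<close>

lemma normal_law_moments:
  assumes v: "0 \<le> v"
  shows "integrable (normal_law 0 v) (\<lambda>x. x)" "integral\<^sup>L (normal_law 0 v) (\<lambda>x. x) = 0"
    and "integrable (normal_law 0 v) (\<lambda>x. x\<^sup>2)" "integral\<^sup>L (normal_law 0 v) (\<lambda>x. x\<^sup>2) = v"
proof -
  have "integrable (normal_law 0 v) (\<lambda>x. x) \<and> integral\<^sup>L (normal_law 0 v) (\<lambda>x. x) = 0 \<and>
    integrable (normal_law 0 v) (\<lambda>x. x\<^sup>2) \<and> integral\<^sup>L (normal_law 0 v) (\<lambda>x. x\<^sup>2) = v"
  proof (cases "v = 0")
    case True
    have "has_bochner_integral (return borel 0) (\<lambda>x. x ^ k) (0::real)" if "0 < k" for k :: nat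
    proof -
      have ae: "AE x in return borel (0::real). x ^ k = 0"
        using that by (subst AE_return) simp_all
      show ?thesis
        by (rule has_bochner_integral_cong_AE[THEN iffD2, OF _ _ ae has_bochner_integral_zero]) simp_all
    qed
    note this[of 1] this[of 2]
    moreover have "normal_law 0 v = return borel 0"
      using True by (simp add: normal_law_def)
    ultimately show ?thesis
      using True by (simp only: has_bochner_integral_iff power_one_right)
  next
    case False
    then have s: "0 < sqrt v" using v by simp
    have law: "normal_law 0 v = density lborel (\<lambda>x. ennreal (normal_density 0 (sqrt v) x))"
      using False by (simp add: normal_law_def)
    have 1: "has_bochner_integral lborel (\<lambda>x. normal_density 0 (sqrt v) x *\<^sub>R x) 0"
      using normal_moment_nz_1[OF s, of 0] by (simp only: real_scaleR_def)
    have "fact (2 * 1) / ((2 / (sqrt v)\<^sup>2) ^ 1 * fact 1) = v"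
      using v by (simp add: fact_2)
    then have 2: "has_bochner_integral lborel (\<lambda>x. normal_density 0 (sqrt v) x *\<^sub>R x\<^sup>2) v"
      using normal_moment_even[OF s, of 0 1] by (simp only: real_scaleR_def mult_1_right diff_zero)
    have "has_bochner_integral (normal_law 0 v) (\<lambda>x. x) 0"
      unfolding law by (rule has_bochner_integral_density[OF _ _ _ 1]) (simp_all add: normal_density_nonneg)
    moreover have "has_bochner_integral (normal_law 0 v) (\<lambda>x. x\<^sup>2) v"
      unfolding law by (rule has_bochner_integral_density[OF _ _ _ 2]) (simp_all add: normal_density_nonneg)
    ultimately show ?thesis
      by (simp add: has_bochner_integral_iff)
  qed
  then show "integrable (normal_law 0 v) (\<lambda>x. x)" "integral\<^sup>L (normal_law 0 v) (\<lambda>x. x) = 0"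
    "integrable (normal_law 0 v) (\<lambda>x. x\<^sup>2)" "integral\<^sup>L (normal_law 0 v) (\<lambda>x. x\<^sup>2) = v"
    by blast+
qed

lemma gaussian_vector_moments:
  assumes "gaussian_vector P X 0 Q"
  shows "integrable P (\<lambda>\<omega>. u \<bullet> X \<omega>)" "(\<integral>\<omega>. u \<bullet> X \<omega> \<partial>P) = 0"
    and "integrable P (\<lambda>\<omega>. (u \<bullet> X \<omega>)\<^sup>2)" "(\<integral>\<omega>. (u \<bullet> X \<omega>)\<^sup>2 \<partial>P) = u \<bullet> (Q *v u)"
proof -
  have X[measurable]: "X \<in> borel_measurable P" and psd: "0 \<le> u \<bullet> (Q *v u)"
    and law: "distr P borel (\<lambda>\<omega>. u \<bullet> X \<omega>) = normal_law 0 (u \<bullet> (Q *v u))"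
    using assms by (auto simp: gaussian_vector_def pos_semidef_matrix_def)
  have u: "(\<lambda>\<omega>. u \<bullet> X \<omega>) \<in> measurable P borel" by measurable
  note m = normal_law_moments[OF psd, folded law]
  show "integrable P (\<lambda>\<omega>. u \<bullet> X \<omega>)" "integrable P (\<lambda>\<omega>. (u \<bullet> X \<omega>)\<^sup>2)"
    using m(1,3) by (simp_all add: integrable_distr_eq[OF u])
  show "(\<integral>\<omega>. u \<bullet> X \<omega> \<partial>P) = 0" "(\<integral>\<omega>. (u \<bullet> X \<omega>)\<^sup>2 \<partial>P) = u \<bullet> (Q *v u)"
    using m(2,4) by (simp_all add: integral_distr[OF u])
qed

lemma (in prob_space) indep_centered_second_moment:
  fixes X Y :: "'a \<Rightarrow> real"
  assumes ind: "indep_var borel X borel Y"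
    and X: "integrable M X" "expectation X = 0" "integrable M (\<lambda>\<omega>. (X \<omega>)\<^sup>2)"
    and Y: "integrable M Y" "expectation Y = 0" "integrable M (\<lambda>\<omega>. (Y \<omega>)\<^sup>2)"
  shows "integrable M (\<lambda>\<omega>. (c + X \<omega> - Y \<omega>)\<^sup>2)"
    and "expectation (\<lambda>\<omega>. (c + X \<omega> - Y \<omega>)\<^sup>2) =
      c\<^sup>2 + expectation (\<lambda>\<omega>. (X \<omega>)\<^sup>2) + expectation (\<lambda>\<omega>. (Y \<omega>)\<^sup>2)"
proof -
  have expand: "(\<lambda>\<omega>. (c + X \<omega> - Y \<omega>)\<^sup>2) =
      (\<lambda>\<omega>. c\<^sup>2 + (X \<omega>)\<^sup>2 + (Y \<omega>)\<^sup>2 + 2 * c * X \<omega> - 2 * c * Y \<omega> - 2 * (X \<omega> * Y \<omega>))"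
    by (rule ext) (simp only: power2_eq_square ring_distribs mult_2 mult_2_right, simp)
  have XY: "integrable M (\<lambda>\<omega>. X \<omega> * Y \<omega>)" "expectation (\<lambda>\<omega>. X \<omega> * Y \<omega>) = 0"
    using indep_var_integrable[OF ind X(1) Y(1)] indep_var_lebesgue_integral[OF ind X(1) Y(1)] X(2)
    by simp_all
  show "integrable M (\<lambda>\<omega>. (c + X \<omega> - Y \<omega>)\<^sup>2)"
    unfolding expand using X(1,3) Y(1,3) XY(1) by simp
  show "expectation (\<lambda>\<omega>. (c + X \<omega> - Y \<omega>)\<^sup>2) =
      c\<^sup>2 + expectation (\<lambda>\<omega>. (X \<omega>)\<^sup>2) + expectation (\<lambda>\<omega>. (Y \<omega>)\<^sup>2)"
    unfolding expand using X Y XY by (simp add: prob_space)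
qed

lemma sum_rows_quadratic_form:
  fixes A :: "real^'d^'n" and Q :: "real^'d^'d"
  shows "(\<Sum>i\<in>UNIV. A $ i \<bullet> (Q *v A $ i)) = trace (transpose A ** A ** Q)"
proof -
  have "(A ** Q ** transpose A) $ i $ i = A $ i \<bullet> (Q *v A $ i)" for i
  proof -
    have "(A ** Q ** transpose A) $ i $ i = (A $ i v* Q) \<bullet> A $ i"
      by (simp add: matrix_matrix_mult_def vector_matrix_mult_def transpose_def inner_vec_def mult.commute)
    then show ?thesis
      by (simp only: dot_lmul_matrix)
  qed
  then have "(\<Sum>i\<in>UNIV. A $ i \<bullet> (Q *v A $ i)) = trace (A ** Q ** transpose A)"
    by (simp add: trace_def)
  also have "\<dots> = trace (transpose A ** (A ** Q))"
    by (rule trace_mul_sym)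
  finally show ?thesis
    by (simp add: matrix_mul_assoc)
qed

lemma norm_sq_eq_sum_components:
  fixes x :: "real^'n"
  shows "(norm x)\<^sup>2 = (\<Sum>i\<in>UNIV. (x $ i)\<^sup>2)"
  unfolding power2_norm_eq_inner inner_vec_def by (simp add: power2_eq_square)

text \<open>Computed coordinate by coordinate: the \<open>i\<close>-th coordinates of \<open>A U\<close> and \<open>B V\<close> are independent centred
  real variables whose variances are the values of the covariance forms at the \<open>i\<close>-th rows. Summed over the
  rows, these values give the traces.\<close>

lemma (in prob_space) gaussian_difference_second_moment:
  fixes U V :: "'a \<Rightarrow> real^'d" and A B :: "real^'d^'n" and c :: "real^'n"
  assumes U: "gaussian_vector M U 0 Q" and V: "gaussian_vector M V 0 R"
    and ind: "indep_var borel U borel V"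
  shows "(\<integral>\<^sup>+\<omega>. ennreal ((norm (c + A *v U \<omega> - B *v V \<omega>))\<^sup>2) \<partial>M) =
    ennreal ((norm c)\<^sup>2 + trace (transpose A ** A ** Q) + trace (transpose B ** B ** R))"
proof -
  have comp: "indep_var borel (\<lambda>\<omega>. A $ i \<bullet> U \<omega>) borel (\<lambda>\<omega>. B $ i \<bullet> V \<omega>)" for i
    using indep_var_compose[OF ind, of "\<lambda>x. A $ i \<bullet> x" borel "\<lambda>x. B $ i \<bullet> x" borel]
    by (simp add: comp_def)
  note mom = indep_centered_second_moment[OF comp gaussian_vector_moments(1-3)[OF U]
      gaussian_vector_moments(1-3)[OF V]]
  have sq: "(norm (c + A *v U \<omega> - B *v V \<omega>))\<^sup>2 = (\<Sum>i\<in>UNIV. (c $ i + A $ i \<bullet> U \<omega> - B $ i \<bullet> V \<omega>)\<^sup>2)" for \<omega>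
    by (simp add: norm_sq_eq_sum_components matrix_vector_mul_component)
  have "(\<integral>\<^sup>+\<omega>. ennreal ((norm (c + A *v U \<omega> - B *v V \<omega>))\<^sup>2) \<partial>M) =
      ennreal (\<integral>\<omega>. (\<Sum>i\<in>UNIV. (c $ i + A $ i \<bullet> U \<omega> - B $ i \<bullet> V \<omega>)\<^sup>2) \<partial>M)"
    unfolding sq using mom(1) by (intro nn_integral_eq_integral) (auto intro!: sum_nonneg)
  also have "(\<integral>\<omega>. (\<Sum>i\<in>UNIV. (c $ i + A $ i \<bullet> U \<omega> - B $ i \<bullet> V \<omega>)\<^sup>2) \<partial>M) =
      (\<Sum>i\<in>UNIV. (c $ i)\<^sup>2 + A $ i \<bullet> (Q *v A $ i) + B $ i \<bullet> (R *v B $ i))"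
    using mom by (simp add: gaussian_vector_moments(4)[OF U] gaussian_vector_moments(4)[OF V])
  also have "\<dots> = (norm c)\<^sup>2 + trace (transpose A ** A ** Q) + trace (transpose B ** B ** R)"
    by (simp add: sum.distrib sum_rows_quadratic_form norm_sq_eq_sum_components)
  finally show ?thesis .
qed

section \<open>Independence of the states from the future noise\<close>

lemma measurable_matrix_vector_mult[measurable]:
  fixes A :: "'a \<Rightarrow> real^'d^'n" and x :: "'a \<Rightarrow> real^'d"
  assumes "A \<in> borel_measurable N" "x \<in> borel_measurable N"
  shows "(\<lambda>\<omega>. A \<omega> *v x \<omega>) \<in> borel_measurable N"
proof (rule borel_measurable_continuous_Pair[OF assms])
  have "continuous_on UNIV (\<lambda>p. fst p *v snd p :: real^'n)"
    unfolding matrix_vector_mult_def by (intro continuous_intros)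
  then show "continuous_on UNIV (\<lambda>p. fst p *v snd p :: real^'n)" .
qed

definition noise_tail :: "(nat \<Rightarrow> 'w \<Rightarrow> real^'d) \<Rightarrow> nat \<Rightarrow> 'w \<Rightarrow> nat \<Rightarrow> real^'d" where
  "noise_tail w k \<omega> = restrict (\<lambda>i. w i \<omega>) {Suc k..}"

abbreviation tail_space :: "nat \<Rightarrow> (nat \<Rightarrow> real^'d) measure" where
  "tail_space k \<equiv> \<Pi>\<^sub>M i\<in>{Suc k..}. borel"

lemma noise_tail_Suc: "noise_tail w (Suc k) \<omega> = restrict (noise_tail w k \<omega>) {Suc (Suc k)..}"
  by (auto simp: noise_tail_def)

lemma noise_tail_hd: "noise_tail w k \<omega> (Suc k) = w (Suc k) \<omega>"
  by (simp add: noise_tail_def)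

lemma measurable_tail_split[measurable]:
  "(\<lambda>p. p (Suc k)) \<in> measurable (tail_space k) borel"
  "(\<lambda>p. restrict p {Suc (Suc k)..}) \<in> measurable (tail_space k) (tail_space (Suc k))"
  by (auto intro: measurable_component_singleton measurable_restrict_subset)

context prob_space
begin

lemma noise_indep_tail:
  assumes "gaussian_noise M Q w"
  shows "indep_rv M borel (w (Suc k)) (tail_space (Suc k)) (noise_tail w (Suc k))"
proof -
  have "indep_vars (\<lambda>_. borel) w {1..}"
    using assms by (simp add: gaussian_noise_def)
  then have "indep_var (PiM {Suc k} (\<lambda>_. borel)) (\<lambda>\<omega>. restrict (\<lambda>i. w i \<omega>) {Suc k})
      (tail_space (Suc k)) (noise_tail w (Suc k))"
    unfolding noise_tail_def[abs_def] by (rule indep_var_restrict) auto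
  then have "indep_rv M (PiM {Suc k} (\<lambda>_. borel)) (\<lambda>\<omega>. restrict (\<lambda>i. w i \<omega>) {Suc k})
      (tail_space (Suc k)) (noise_tail w (Suc k))"
    by (simp add: indep_rv_eq_indep_var)
  from indep_rv_compose[OF this, of "\<lambda>p. p (Suc k)" borel "\<lambda>p. p"] show ?thesis
    by (simp add: measurable_component_singleton)
qed

lemma noise_pair_indep_tails:
  assumes w: "gaussian_noise M Q w" and w': "gaussian_noise M Q' w'"
    and ind: "indep_rv M noise_space (noise_path w) noise_space (noise_path w')"
  shows "indep_rv M (borel \<Otimes>\<^sub>M borel) (\<lambda>\<omega>. (w (Suc k) \<omega>, w' (Suc k) \<omega>))
    (tail_space (Suc k) \<Otimes>\<^sub>M tail_space (Suc k)) (\<lambda>\<omega>. (noise_tail w (Suc k) \<omega>, noise_tail w' (Suc k) \<omega>))"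
proof (rule indep_rv_interchange[OF _ noise_indep_tail[OF w] noise_indep_tail[OF w']])
  let ?s = "\<lambda>p :: nat \<Rightarrow> real^'d. (p (Suc k), restrict p {Suc (Suc k)..})"
  have s: "?s \<in> measurable noise_space (borel \<Otimes>\<^sub>M tail_space (Suc k))"
    by (intro measurable_Pair measurable_component_singleton measurable_restrict_subset) auto
  have eq: "?s (noise_path v \<omega>) = (v (Suc k) \<omega>, noise_tail v (Suc k) \<omega>)" for v \<omega>
    by (auto simp: noise_path_def noise_tail_def)
  show "indep_rv M (borel \<Otimes>\<^sub>M tail_space (Suc k)) (\<lambda>\<omega>. (w (Suc k) \<omega>, noise_tail w (Suc k) \<omega>))
      (borel \<Otimes>\<^sub>M tail_space (Suc k)) (\<lambda>\<omega>. (w' (Suc k) \<omega>, noise_tail w' (Suc k) \<omega>))"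
    using indep_rv_compose[OF ind s s] unfolding eq .
qed

lemma noise_indep_at:
  assumes ind: "indep_rv M noise_space (noise_path w) noise_space (noise_path w')"
  shows "indep_var borel (w (Suc k)) borel (w' (Suc k))"
proof -
  have "(\<lambda>p. p (Suc k)) \<in> measurable noise_space borel"
    by (intro measurable_component_singleton) auto
  from indep_rv_compose[OF ind this this] show ?thesis
    by (simp add: noise_path_def indep_rv_eq_indep_var)
qed

text \<open>The pair of next states is a function of the present states and the next noise values. Both are
  independent of the noise after the next step, jointly so because the states are independent of
  everything that is still to come.\<close>

lemma trajectory_indep_future_noise:
  fixes f :: "real^'n \<Rightarrow> nat \<Rightarrow> real^'n" and \<sigma> :: "real^'n \<Rightarrow> nat \<Rightarrow> real^'d^'n"
  assumes f[measurable]: "\<And>k. (\<lambda>x. f x k) \<in> borel_measurable borel"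
    and \<sigma>[measurable]: "\<And>k. (\<lambda>x. \<sigma> x k) \<in> borel_measurable borel"
    and w: "gaussian_noise M Q w" and w': "gaussian_noise M Q' w'"
    and ww': "indep_rv M noise_space (noise_path w) noise_space (noise_path w')"
    and init: "indep_rv M borel (\<lambda>\<omega>. (a 0 \<omega>, b 0 \<omega>))
           (noise_space \<Otimes>\<^sub>M noise_space) (\<lambda>\<omega>. (noise_path w \<omega>, noise_path w' \<omega>))"
    and a: "trajectory M f \<sigma> w a" and b: "trajectory M f \<sigma> w' b"
  shows "indep_rv M (borel \<Otimes>\<^sub>M borel) (\<lambda>\<omega>. (a k \<omega>, b k \<omega>))
    (tail_space k \<Otimes>\<^sub>M tail_space k) (\<lambda>\<omega>. (noise_tail w k \<omega>, noise_tail w' k \<omega>))"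
proof (induction k)
  case 0
  have "noise_path v = noise_tail v 0" for v :: "nat \<Rightarrow> 'a \<Rightarrow> real^'d"
    by (auto simp: noise_path_def noise_tail_def)
  then show ?case
    using init by (simp add: borel_prod)
next
  case (Suc k)
  let ?P = "borel \<Otimes>\<^sub>M borel :: ((real^'n) \<times> (real^'n)) measure"
  let ?N = "borel \<Otimes>\<^sub>M borel :: ((real^'d) \<times> (real^'d)) measure"
  let ?T = "tail_space (Suc k) \<Otimes>\<^sub>M tail_space (Suc k) :: ((nat \<Rightarrow> real^'d) \<times> (nat \<Rightarrow> real^'d)) measure"
  let ?tails = "\<lambda>\<omega>. (noise_tail w (Suc k) \<omega>, noise_tail w' (Suc k) \<omega>)"
  define s :: "(nat \<Rightarrow> real^'d) \<times> (nat \<Rightarrow> real^'d) \<Rightarrow> _"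
    where "s = (\<lambda>(p, q). ((p (Suc k), q (Suc k)), (restrict p {Suc (Suc k)..}, restrict q {Suc (Suc k)..})))"
  have s: "s \<in> measurable (tail_space k \<Otimes>\<^sub>M tail_space k) (?N \<Otimes>\<^sub>M ?T)"
    unfolding s_def by measurable
  have [measurable (raw)]: "(\<lambda>z. f (g z) k) \<in> borel_measurable N"
    if "g \<in> borel_measurable N" for g :: "(real^'n \<times> real^'n) \<times> (real^'d \<times> real^'d) \<Rightarrow> real^'n" and N
    by (rule measurable_compose[OF that f])
  have [measurable (raw)]: "(\<lambda>z. \<sigma> (g z) k) \<in> borel_measurable N"
    if "g \<in> borel_measurable N" for g :: "(real^'n \<times> real^'n) \<times> (real^'d \<times> real^'d) \<Rightarrow> real^'n" and N
    by (rule measurable_compose[OF that \<sigma>])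
  have "indep_rv M ?P (\<lambda>\<omega>. (a k \<omega>, b k \<omega>)) (?N \<Otimes>\<^sub>M ?T) (\<lambda>\<omega>. ((w (Suc k) \<omega>, w' (Suc k) \<omega>), ?tails \<omega>))"
    using indep_rv_compose[OF Suc.IH measurable_ident_sets[OF refl] s]
    by (simp add: s_def noise_tail_Suc noise_tail_hd)
  from indep_rv_assoc[OF this noise_pair_indep_tails[OF w w' ww']]
  have "indep_rv M (?P \<Otimes>\<^sub>M ?N) (\<lambda>\<omega>. ((a k \<omega>, b k \<omega>), (w (Suc k) \<omega>, w' (Suc k) \<omega>))) ?T ?tails" .
  then have "indep_rv M ?P (\<lambda>\<omega>. (\<lambda>((x, y), (u, v)). (f x k + \<sigma> x k *v u, f y k + \<sigma> y k *v v))
      ((a k \<omega>, b k \<omega>), (w (Suc k) \<omega>, w' (Suc k) \<omega>))) ?T (\<lambda>\<omega>. ?tails \<omega>)"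
  proof (rule indep_rv_compose[OF _ _ measurable_ident_sets[OF refl]])
    show "(\<lambda>((x, y), (u, v)). (f x k + \<sigma> x k *v u, f y k + \<sigma> y k *v v)) \<in> measurable (?P \<Otimes>\<^sub>M ?N) ?P"
      unfolding split_beta' by measurable
  qed
  then have step: "indep_rv M ?P (\<lambda>\<omega>. (f (a k \<omega>) k + \<sigma> (a k \<omega>) k *v w (Suc k) \<omega>,
      f (b k \<omega>) k + \<sigma> (b k \<omega>) k *v w' (Suc k) \<omega>)) ?T ?tails"
    by (simp only: prod.case)
  show ?case
    by (rule indep_rv_cong[OF step]) (use a b in \<open>auto simp: trajectory_def\<close>)
qed

end

section \<open>The mean square recursion\<close>

lemma (in prob_space) mean_square_step:
  fixes f :: "real^'n \<Rightarrow> nat \<Rightarrow> real^'n" and \<sigma> :: "real^'n \<Rightarrow> nat \<Rightarrow> real^'d^'n"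
  assumes f[measurable]: "\<And>k. (\<lambda>x. f x k) \<in> borel_measurable borel"
    and \<sigma>[measurable]: "\<And>k. (\<lambda>x. \<sigma> x k) \<in> borel_measurable borel"
    and \<beta>: "0 \<le> \<beta>" and C: "0 \<le> C"
    and contr: "\<And>x y. (norm (\<Theta> (Suc k) *v (f x k - f y k)))\<^sup>2 \<le> \<beta> * (norm (\<Theta> k *v (x - y)))\<^sup>2"
    and tr: "\<And>x. trace (transpose (\<sigma> x k) ** (transpose (\<Theta> (Suc k)) ** \<Theta> (Suc k)) ** \<sigma> x k ** Q (Suc k)) \<le> C"
    and w: "gaussian_noise M Q w" and w': "gaussian_noise M Q w'"
    and ww': "indep_rv M noise_space (noise_path w) noise_space (noise_path w')"
    and init: "indep_rv M borel (\<lambda>\<omega>. (a 0 \<omega>, b 0 \<omega>))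
           (noise_space \<Otimes>\<^sub>M noise_space) (\<lambda>\<omega>. (noise_path w \<omega>, noise_path w' \<omega>))"
    and a: "trajectory M f \<sigma> w a" and b: "trajectory M f \<sigma> w' b"
  shows "(\<integral>\<^sup>+\<omega>. ennreal ((norm (\<Theta> (Suc k) *v (a (Suc k) \<omega> - b (Suc k) \<omega>)))\<^sup>2) \<partial>M)
    \<le> ennreal \<beta> * (\<integral>\<^sup>+\<omega>. ennreal ((norm (\<Theta> k *v (a k \<omega> - b k \<omega>)))\<^sup>2) \<partial>M) + ennreal (2 * C)"
proof -
  let ?T = "\<Theta> (Suc k)" and ?w = "w (Suc k)" and ?w' = "w' (Suc k)"
  have [measurable (raw)]: "(\<lambda>z. f (g z) k) \<in> borel_measurable N"
    if "g \<in> borel_measurable N" for g :: "(real^'n \<times> real^'n) \<times> (real^'d \<times> real^'d) \<Rightarrow> real^'n" and N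
    by (rule measurable_compose[OF that f])
  have [measurable (raw)]: "(\<lambda>z. \<sigma> (g z) k) \<in> borel_measurable N"
    if "g \<in> borel_measurable N" for g :: "(real^'n \<times> real^'n) \<times> (real^'d \<times> real^'d) \<Rightarrow> real^'n" and N
    by (rule measurable_compose[OF that \<sigma>])
  \<comment> \<open>The squared distance after the step as a function of states and noise values, written as a constant
    plus noise so that the Gaussian second moment applies to it with the states fixed.\<close>
  define h where "h = (\<lambda>((x, y), (u, v)).
    ennreal ((norm (?T *v (f x k - f y k) + (?T ** \<sigma> x k) *v u - (?T ** \<sigma> y k) *v v))\<^sup>2))"
  have h: "h ((x, y), (u, v)) =
      ennreal ((norm (?T *v ((f x k + \<sigma> x k *v u) - (f y k + \<sigma> y k *v v))))\<^sup>2)" for x y u v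
    by (simp add: h_def matrix_vector_mul_assoc[symmetric] matrix_vector_mult_diff_distrib
        matrix_vector_right_distrib algebra_simps)
  have h_meas: "h \<in> borel_measurable ((borel \<Otimes>\<^sub>M borel) \<Otimes>\<^sub>M (borel \<Otimes>\<^sub>M borel))"
  proof -
    have "h = (\<lambda>((x, y), (u, v)). ennreal ((norm (?T *v ((f x k + \<sigma> x k *v u) - (f y k + \<sigma> y k *v v))))\<^sup>2))"
      by (auto simp: h)
    then show ?thesis by (simp add: split_beta')
  qed
  have ind: "indep_rv M (borel \<Otimes>\<^sub>M borel) (\<lambda>\<omega>. (a k \<omega>, b k \<omega>)) (borel \<Otimes>\<^sub>M borel) (\<lambda>\<omega>. (?w \<omega>, ?w' \<omega>))"
  proof -
    have "(\<lambda>(p, q). (p (Suc k), q (Suc k))) \<in>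
        measurable (tail_space k \<Otimes>\<^sub>M tail_space k) (borel \<Otimes>\<^sub>M borel :: ((real^'d) \<times> (real^'d)) measure)"
      by measurable
    from indep_rv_compose[OF trajectory_indep_future_noise[OF f \<sigma> w w' ww' init a b]
        measurable_ident_sets[OF refl] this]
    show ?thesis by (simp add: noise_tail_hd)
  qed
  have [measurable]: "a k \<in> borel_measurable M" "b k \<in> borel_measurable M"
    using ind by (auto simp: indep_rv_def dest: measurable_Pair_compose_split)
  have gauss: "gaussian_vector M ?w 0 (Q (Suc k))" "gaussian_vector M ?w' 0 (Q (Suc k))"
    using w w' by (auto simp: gaussian_noise_def)
  have inner: "(\<integral>\<^sup>+\<omega>'. h ((x, y), (?w \<omega>', ?w' \<omega>')) \<partial>M)
      \<le> ennreal \<beta> * ennreal ((norm (\<Theta> k *v (x - y)))\<^sup>2) + ennreal (2 * C)" for x y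
  proof -
    have tr': "trace (transpose (?T ** \<sigma> z k) ** (?T ** \<sigma> z k) ** Q (Suc k)) \<le> C" for z
      using tr[of z] by (simp add: matrix_transpose_mul matrix_mul_assoc)
    have "(\<integral>\<^sup>+\<omega>'. h ((x, y), (?w \<omega>', ?w' \<omega>')) \<partial>M) =
        ennreal ((norm (?T *v (f x k - f y k)))\<^sup>2
          + trace (transpose (?T ** \<sigma> x k) ** (?T ** \<sigma> x k) ** Q (Suc k))
          + trace (transpose (?T ** \<sigma> y k) ** (?T ** \<sigma> y k) ** Q (Suc k)))"
      unfolding h_def prod.case
      by (rule gaussian_difference_second_moment[OF gauss noise_indep_at[OF ww']])
    also have "\<dots> \<le> ennreal (\<beta> * (norm (\<Theta> k *v (x - y)))\<^sup>2 + 2 * C)"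
      using contr[of x y] tr'[of x] tr'[of y] by (intro ennreal_leI) linarith
    also have "\<dots> = ennreal \<beta> * ennreal ((norm (\<Theta> k *v (x - y)))\<^sup>2) + ennreal (2 * C)"
      using \<beta> C by (simp add: ennreal_plus ennreal_mult)
    finally show ?thesis .
  qed
  have "(\<integral>\<^sup>+\<omega>. ennreal ((norm (?T *v (a (Suc k) \<omega> - b (Suc k) \<omega>)))\<^sup>2) \<partial>M)
      = (\<integral>\<^sup>+\<omega>. h ((a k \<omega>, b k \<omega>), (?w \<omega>, ?w' \<omega>)) \<partial>M)"
    using a b by (intro nn_integral_cong) (simp add: h trajectory_def)
  also have "\<dots> = (\<integral>\<^sup>+\<omega>. (\<integral>\<^sup>+\<omega>'. h ((a k \<omega>, b k \<omega>), (?w \<omega>', ?w' \<omega>')) \<partial>M) \<partial>M)"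
    by (rule nn_integral_indep_rv[OF ind h_meas])
  also have "\<dots> \<le> (\<integral>\<^sup>+\<omega>. ennreal \<beta> * ennreal ((norm (\<Theta> k *v (a k \<omega> - b k \<omega>)))\<^sup>2) + ennreal (2 * C) \<partial>M)"
    by (intro nn_integral_mono inner)
  also have "\<dots> = ennreal \<beta> * (\<integral>\<^sup>+\<omega>. ennreal ((norm (\<Theta> k *v (a k \<omega> - b k \<omega>)))\<^sup>2) \<partial>M) + ennreal (2 * C)"
    by (simp add: nn_integral_add nn_integral_cmult emeasure_space_1)
  finally show ?thesis .
qed

lemma affine_recursion_bound:
  fixes N :: "nat \<Rightarrow> ennreal"
  assumes step: "\<And>k. N (Suc k) \<le> ennreal \<beta> * N k + ennreal c"
    and \<beta>: "0 \<le> \<beta>" "\<beta> < 1" and c: "0 \<le> c"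
  shows "N k \<le> ennreal (c / (1 - \<beta>)) + ennreal (\<beta> ^ k) * N 0"
proof (induction k)
  case 0
  show ?case by simp
next
  case (Suc k)
  define L where "L = c / (1 - \<beta>)"
  have L: "0 \<le> L" "\<beta> * L + c = L"
    using \<beta> c by (simp_all add: L_def field_simps)
  have "N (Suc k) \<le> ennreal \<beta> * (ennreal L + ennreal (\<beta> ^ k) * N 0) + ennreal c"
    unfolding L_def by (rule order_trans[OF step]) (intro add_right_mono mult_left_mono Suc.IH zero_le)
  also have "\<dots> = (ennreal \<beta> * ennreal L + ennreal c) + ennreal \<beta> * ennreal (\<beta> ^ k) * N 0"
    by (simp add: distrib_left ac_simps)
  also have "ennreal \<beta> * ennreal L + ennreal c = ennreal (\<beta> * L + c)"
    using \<beta> c L(1) by (simp add: ennreal_mult ennreal_plus)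
  also have "\<beta> * L + c = c / (1 - \<beta>)"
    using L(2) by (simp only: L_def)
  also have "ennreal \<beta> * ennreal (\<beta> ^ k) = ennreal (\<beta> ^ Suc k)"
    using \<beta> by (simp add: ennreal_mult)
  finally show ?case .
qed

theorem mainTheorem2:
  fixes P :: "'w measure"
    and f :: "real^'n \<Rightarrow> nat \<Rightarrow> real^'n"
    and \<sigma> :: "real^'n \<Rightarrow> nat \<Rightarrow> real^'d^'n"
    and M \<Theta> :: "nat \<Rightarrow> real^'n^'n"
    and Q :: "nat \<Rightarrow> real^'d^'d"
    and w w' :: "nat \<Rightarrow> 'w \<Rightarrow> real^'d"
    and a b :: "nat \<Rightarrow> 'w \<Rightarrow> real^'n"
    and \<beta> C :: real
  assumes "prob_space P"
    and "\<And>k. smooth_map (\<lambda>x. f x k)"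
    and "\<And>k. (\<lambda>x. \<sigma> x k) \<in> borel_measurable borel"
    and "\<And>k. invertible (\<Theta> k)"
    and "\<And>k. M k = transpose (\<Theta> k) ** \<Theta> k"
    and "\<And>k. pos_def_matrix (M k)"
    and "uniformly_pos_def M"
    and "0 < \<beta>" and "\<beta> < 1" and "0 \<le> C"
    and "\<And>k x. lambda_max (transpose (gen_jacobian f \<Theta> k x) ** gen_jacobian f \<Theta> k x) \<le> \<beta>"
    and "\<And>k x. trace (transpose (\<sigma> x k) ** M (Suc k) ** \<sigma> x k ** Q (Suc k)) \<le> C"
    and "gaussian_noise P Q w"
    and "gaussian_noise P Q w'"
    and "indep_rv P noise_space (noise_path w) noise_space (noise_path w')"
    and "indep_rv P borel (\<lambda>\<omega>. (a 0 \<omega>, b 0 \<omega>))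
           (noise_space \<Otimes>\<^sub>M noise_space) (\<lambda>\<omega>. (noise_path w \<omega>, noise_path w' \<omega>))"
    and "trajectory P f \<sigma> w a"
    and "trajectory P f \<sigma> w' b"
  shows "\<forall>k. (\<integral>\<^sup>+ \<omega>. ennreal (sq_norm_wrt (M k) (a k \<omega> - b k \<omega>)) \<partial>P)
           \<le> ennreal (2 * C / (1 - \<beta>))
             + ennreal (\<beta> ^ k) * (\<integral>\<^sup>+ \<omega>. ennreal (sq_norm_wrt (M 0) (a 0 \<omega> - b 0 \<omega>)) \<partial>P)"
proof -
  interpret prob_space P by fact
  have diff: "(\<lambda>x. f x k) differentiable (at x)" for k x
    using assms(2)[of k] unfolding smooth_map_def by (auto dest: spec[of _ "Suc 0"])
  have "continuous_on UNIV (\<lambda>x. f x k)" for k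
    using assms(2)[of k] unfolding smooth_map_def by (auto dest: spec[of _ 0])
  then have f: "(\<lambda>x. f x k) \<in> borel_measurable borel" for k
    by (rule borel_measurable_continuous_onI)
  note contr = norm_contraction[OF diff assms(4) less_imp_le[OF assms(8)] assms(11)]
  have step: "(\<integral>\<^sup>+\<omega>. ennreal ((norm (\<Theta> (Suc k) *v (a (Suc k) \<omega> - b (Suc k) \<omega>)))\<^sup>2) \<partial>P)
      \<le> ennreal \<beta> * (\<integral>\<^sup>+\<omega>. ennreal ((norm (\<Theta> k *v (a k \<omega> - b k \<omega>)))\<^sup>2) \<partial>P) + ennreal (2 * C)" for k
    by (rule mean_square_step[OF f assms(3) less_imp_le[OF assms(8)] assms(10) contr
          assms(12)[unfolded assms(5)] assms(13-18)])
  have sq: "sq_norm_wrt (M k) x = (norm (\<Theta> k *v x))\<^sup>2" for k x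
    unfolding assms(5) by (rule sq_norm_wrt_gram)
  show ?thesis
    unfolding sq
  proof
    fix k
    show "(\<integral>\<^sup>+\<omega>. ennreal ((norm (\<Theta> k *v (a k \<omega> - b k \<omega>)))\<^sup>2) \<partial>P)
      \<le> ennreal (2 * C / (1 - \<beta>))
        + ennreal (\<beta> ^ k) * (\<integral>\<^sup>+\<omega>. ennreal ((norm (\<Theta> 0 *v (a 0 \<omega> - b 0 \<omega>)))\<^sup>2) \<partial>P)"
      by (rule affine_recursion_bound[where
            N = "\<lambda>k. \<integral>\<^sup>+\<omega>. ennreal ((norm (\<Theta> k *v (a k \<omega> - b k \<omega>)))\<^sup>2) \<partial>P", OF step])
         (use assms(8-10) in simp_all)
  qed
qed

end
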